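(* For every integer $n \ge 2$, the small rank of the semigroup $A^+(B_n)$ is $r_1(A^+(B_n)) = 1$.
   Context: Brandt semigroup. For $n\ge 1$ let $[n]=\{1,\dots,n\}$ and $B_n = ([n]\times[n])\cup\{\vartheta\}$, with the (non-commutative) operation $+$ given by $(i,j)+(k,l)=(i,l)$ if $j=k$ and $(i,j)+(k,l)=\vartheta$ otherwise, and $\vartheta+x=x+\vartheta=\vartheta$ for all $x\in B_n$. Affine maps. Arguments of functions are written on the left ($xf$ is the value of $f$ at $x$), so $x(fg)=(xf)g$. Let $M(B_n)$ be the set of all maps $B_n\to B_n$, with pointwise addition $+$ and composition. A map is affine if it equals $g+h$ with $g$ an endomorphism of $(B_n,+)$ and $h$ a constant map; $\mathrm{Aff}(B_n)$ is the set of affine maps. $A^+(B_n)$ is the smallest subset of $M(B_n)$ containing $\mathrm{Aff}(B_n)$ and closed under $+$ and composition; here it is regarded as a semigroup under composition only. Explicit description (known). For $c\in B_n$ let $\xi_c$ be the constant map with value $c$; for $k,l,p,q\in[n]$ let ${}^{(k,l)}\zeta_{(p,q)}$ be the map sending $(k,l)$ to $(p,q)$ and all other elements to $\vartheta$; for $p,q\in[n]$ and a permutation $\sigma\in S_n$ let $(p,q;\sigma)$ be the map sending $(i,p)$ to $(i\sigma,q)$ for all $i\in[n]$ and all other elements to $\vartheta$. For $n\ge 2$, $A^+(B_n)=\{(p,q;\sigma): p,q\in[n],\sigma\in S_n\}\cup\{\xi_c : c\in B_n\}\cup\{{}^{(k,l)}\zeta_{(p,q)}: k,l,p,q\in[n]\}$.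 Rank. A subset $U$ of a semigroup $\Gamma$ is independent if $a\notin\langle U\setminus\{a\}\rangle$ for every $a\in U$, where $\langle X\rangle$ is the subsemigroup generated by $X$ (with $\langle\emptyset\rangle=\emptyset$). For a finite semigroup $\Gamma$, the small rank is $r_1(\Gamma)=\max\{k : \text{every subset } U \text{ of cardinality } k \text{ in } \Gamma \text{ is independent}\}$. *)

theory Defs
  imports Main "HOL-Library.FuncSet"
begin

datatype brandt = Theta | Pr nat nat

definition brandt_carrier :: "nat \<Rightarrow> brandt set" where
  "brandt_carrier n = insert Theta {Pr i j | i j. i \<in> {1..n} \<and> j \<in> {1..n}}"

fun brandt_add :: "brandt \<Rightarrow> brandt \<Rightarrow> brandt" where
  "brandt_add (Pr i j) (Pr k l) = (if j = k then Pr i l else Theta)"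
| "brandt_add Theta y = Theta"
| "brandt_add x Theta = Theta"

text \<open>Self-maps of the carrier are extensional functions (value \<open>undefined\<close> outside the carrier),
  so that equality of HOL functions is equality of maps on the carrier.\<close>

definition brandt_maps :: "nat \<Rightarrow> (brandt \<Rightarrow> brandt) set" where
  "brandt_maps n = brandt_carrier n \<rightarrow>\<^sub>E brandt_carrier n"

definition brandt_map_add :: "nat \<Rightarrow> (brandt \<Rightarrow> brandt) \<Rightarrow> (brandt \<Rightarrow> brandt) \<Rightarrow> brandt \<Rightarrow> brandt" where
  "brandt_map_add n f g = (\<lambda>x\<in>brandt_carrier n. brandt_add (f x) (g x))"

text \<open>Arguments are written on the left in the source, \<open>x(fg) = (xf)g\<close>, so the product \<open>fg\<close>
  applies \<open>f\<close> first.\<close>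

definition brandt_map_comp :: "nat \<Rightarrow> (brandt \<Rightarrow> brandt) \<Rightarrow> (brandt \<Rightarrow> brandt) \<Rightarrow> brandt \<Rightarrow> brandt" where
  "brandt_map_comp n f g = (\<lambda>x\<in>brandt_carrier n. g (f x))"

definition brandt_endos :: "nat \<Rightarrow> (brandt \<Rightarrow> brandt) set" where
  "brandt_endos n = {g \<in> brandt_maps n. \<forall>x\<in>brandt_carrier n. \<forall>y\<in>brandt_carrier n.
     g (brandt_add x y) = brandt_add (g x) (g y)}"

definition const_map :: "nat \<Rightarrow> brandt \<Rightarrow> brandt \<Rightarrow> brandt" where
  "const_map n c = (\<lambda>x\<in>brandt_carrier n. c)"

definition affine_maps :: "nat \<Rightarrow> (brandt \<Rightarrow> brandt) set" where
  "affine_maps n =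
     {brandt_map_add n g (const_map n c) | g c. g \<in> brandt_endos n \<and> c \<in> brandt_carrier n}"

inductive_set affine_nearsemiring :: "nat \<Rightarrow> (brandt \<Rightarrow> brandt) set" for n :: nat where
  affine: "f \<in> affine_maps n \<Longrightarrow> f \<in> affine_nearsemiring n"
| add: "f \<in> affine_nearsemiring n \<Longrightarrow> g \<in> affine_nearsemiring n
    \<Longrightarrow> brandt_map_add n f g \<in> affine_nearsemiring n"
| comp: "f \<in> affine_nearsemiring n \<Longrightarrow> g \<in> affine_nearsemiring n
    \<Longrightarrow> brandt_map_comp n f g \<in> affine_nearsemiring n"

text \<open>A semigroup is given below by its carrier \<open>S\<close> and its operation \<open>m\<close>.\<close>

inductive_set generated_subsemigroup :: "('a \<Rightarrow> 'a \<Rightarrow> 'a) \<Rightarrow> 'a set \<Rightarrow> 'a set"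
  for m :: "'a \<Rightarrow> 'a \<Rightarrow> 'a" and X :: "'a set" where
  incl: "x \<in> X \<Longrightarrow> x \<in> generated_subsemigroup m X"
| mult: "x \<in> generated_subsemigroup m X \<Longrightarrow> y \<in> generated_subsemigroup m X
    \<Longrightarrow> m x y \<in> generated_subsemigroup m X"

definition independent_subset :: "('a \<Rightarrow> 'a \<Rightarrow> 'a) \<Rightarrow> 'a set \<Rightarrow> bool" where
  "independent_subset m U \<longleftrightarrow> (\<forall>a\<in>U. a \<notin> generated_subsemigroup m (U - {a}))"

text \<open>Meaningful for finite \<open>S\<close>. The bound \<open>k \<le> card S\<close> is implicit in the usual definition:
  larger \<open>k\<close> would satisfy the condition vacuously and there would be no maximum.\<close>

definition small_rank :: "'a set \<Rightarrow> ('a \<Rightarrow> 'a \<Rightarrow> 'a) \<Rightarrow> nat" where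
  "small_rank S m =
     Max {k. k \<le> card S \<and> (\<forall>U. U \<subseteq> S \<and> card U = k \<longrightarrow> independent_subset m U)}"

end

(* The affine map b = id + (1,2) sends (i,1) to (i,2) and everything else to Theta, so its square is
   the constant map Theta, which differs from b. Hence {b, b^2} and all its supersets are dependent,
   whereas a singleton is always independent because the empty set generates nothing. *)

theory Submission
  imports Defs
begin

lemma generated_subsemigroup_empty [simp]: "generated_subsemigroup m {} = {}"
proof -
  have False if "x \<in> generated_subsemigroup m {}" for x
    using that by induction auto
  then show ?thesis by blast
qed

lemma independent_subset_singleton: "independent_subset m {a}"
  by (simp add: independent_subset_def)

text \<open>Since \<open>b\<close> differs from its square, \<open>b\<close> survives the removal of
  \<open>m b b\<close> from \<open>U\<close>, and so the remaining elements still generate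
  \<open>m b b\<close>.\<close>

lemma not_independent_if_square:
  assumes "b \<in> U" "m b b \<in> U" "m b b \<noteq> b"
  shows "\<not> independent_subset m U"
proof -
  have "b \<in> generated_subsemigroup m (U - {m b b})"
    using assms by (auto intro: generated_subsemigroup.incl)
  then have "m b b \<in> generated_subsemigroup m (U - {m b b})"
    by (intro generated_subsemigroup.mult)
  with \<open>m b b \<in> U\<close> show ?thesis
    by (auto simp: independent_subset_def)
qed

text \<open>One non-idempotent element pins the small rank: singletons are independent, and for
  every \<open>k\<close> from 2 to \<open>card S\<close> the pair \<open>{b, m b b}\<close> extends
  to a dependent subset of size \<open>k\<close>.\<close>

lemma small_rank_eq_1:
  assumes "finite S" "b \<in> S" "m b b \<in> S" "m b b \<noteq> b"
  shows "small_rank S m = 1"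
proof -
  let ?K = "{k. k \<le> card S \<and> (\<forall>U. U \<subseteq> S \<and> card U = k \<longrightarrow> independent_subset m U)}"
  \<comment> \<open>The set whose maximum is taken only admits \<open>k\<close> up to
    \<open>card S\<close>, so membership of 1 requires \<open>S\<close> to be nonempty.\<close>
  have "1 \<le> card S"
    using assms(1,2) by (simp add: Suc_le_eq card_gt_0_iff) blast
  then have "1 \<in> ?K"
    by (auto simp: card_1_singleton_iff independent_subset_singleton)
  moreover have "k \<le> 1" if "k \<in> ?K" for k
  proof (rule ccontr)
    assume "\<not> k \<le> 1"
    then have "card {b, m b b} \<le> k"
      using assms(4) by simp
    then obtain U where "{b, m b b} \<subseteq> U" "U \<subseteq> S" "card U = k"
      using exists_subset_between[of "{b, m b b}" k S] assms(1-3) \<open>k \<in> ?K\<close> by auto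
    with not_independent_if_square[of b U m] assms(4) \<open>k \<in> ?K\<close> show False
      by auto
  qed
  moreover have "finite ?K" by simp
  ultimately show ?thesis
    unfolding small_rank_def by (intro Max_eqI) auto
qed

lemma finite_brandt_carrier: "finite (brandt_carrier n)"
proof -
  have "brandt_carrier n = insert Theta (case_prod Pr ` ({1..n} \<times> {1..n}))"
    by (auto simp: brandt_carrier_def)
  then show ?thesis by simp
qed

lemma brandt_add_closed:
  "x \<in> brandt_carrier n \<Longrightarrow> y \<in> brandt_carrier n \<Longrightarrow> brandt_add x y \<in> brandt_carrier n"
  by (cases "(x, y)" rule: brandt_add.cases) (auto simp: brandt_carrier_def)

lemma brandt_map_add_closed:
  "f \<in> brandt_maps n \<Longrightarrow> g \<in> brandt_maps n \<Longrightarrow> brandt_map_add n f g \<in> brandt_maps n"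
  by (auto simp: brandt_maps_def brandt_map_add_def intro!: brandt_add_closed)

lemma brandt_map_comp_closed:
  "f \<in> brandt_maps n \<Longrightarrow> g \<in> brandt_maps n \<Longrightarrow> brandt_map_comp n f g \<in> brandt_maps n"
  by (auto simp: brandt_maps_def brandt_map_comp_def)

lemma const_map_in_brandt_maps: "c \<in> brandt_carrier n \<Longrightarrow> const_map n c \<in> brandt_maps n"
  by (auto simp: brandt_maps_def const_map_def)

text \<open>Serves to prove finiteness: there are only finitely many extensional self-maps of a
  finite carrier.\<close>

lemma affine_nearsemiring_subset_brandt_maps: "affine_nearsemiring n \<subseteq> brandt_maps n"
proof
  fix f assume "f \<in> affine_nearsemiring n"
  then show "f \<in> brandt_maps n"
  proof induction
    case (affine f)
    then show ?case
      by (auto simp: affine_maps_def brandt_endos_def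
          intro: brandt_map_add_closed const_map_in_brandt_maps)
  qed (auto intro: brandt_map_add_closed brandt_map_comp_closed)
qed

lemma finite_affine_nearsemiring: "finite (affine_nearsemiring n)"
  by (rule finite_subset[OF affine_nearsemiring_subset_brandt_maps])
     (simp add: brandt_maps_def finite_PiE finite_brandt_carrier)

lemma id_in_brandt_endos: "(\<lambda>x\<in>brandt_carrier n. x) \<in> brandt_endos n"
  by (auto simp: brandt_endos_def brandt_maps_def brandt_add_closed)

theorem corollary2p2:
  fixes n :: nat
  assumes "n \<ge> 2"
  shows "small_rank (affine_nearsemiring n) (brandt_map_comp n) = 1"
proof -
  define b where "b = brandt_map_add n (\<lambda>x\<in>brandt_carrier n. x) (const_map n (Pr 1 2))"
  \<comment> \<open>The bound on \<open>n\<close> enters here: the index 2 must lie in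
    \<open>{1..n}\<close>.\<close>
  have in_carrier: "Pr 1 1 \<in> brandt_carrier n" "Pr 1 2 \<in> brandt_carrier n"
    using assms by (auto simp: brandt_carrier_def)
  have "b \<in> affine_maps n"
    unfolding affine_maps_def b_def using id_in_brandt_endos in_carrier(2) by blast
  then have b: "b \<in> affine_nearsemiring n"
    by (rule affine_nearsemiring.affine)
  \<comment> \<open>Adding \<open>Pr 1 2\<close> on the right keeps only pairs with second index 1.
    So \<open>b\<close> moves \<open>Pr 1 1\<close> to \<open>Pr 1 2\<close>, which a second
    application sends to \<open>Theta\<close>; the point \<open>Pr 1 1\<close> separates
    \<open>b\<close> from its square.\<close>
  have "b (Pr 1 1) = Pr 1 2" "b (Pr 1 2) = Theta"
    using in_carrier by (simp_all add: b_def brandt_map_add_def const_map_def)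
  then have "brandt_map_comp n b b (Pr 1 1) \<noteq> b (Pr 1 1)"
    using in_carrier by (simp add: brandt_map_comp_def)
  then have "brandt_map_comp n b b \<noteq> b" by metis
  with finite_affine_nearsemiring b affine_nearsemiring.comp[OF b b] show ?thesis
    by (rule small_rank_eq_1)
qed

end
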